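(* Let $G=(V,E)$ be a finite simple triangle-free graph and let $w\colon E\to\mathbb{R}_+$ be a weight function. Then $\|d_w\|_+=w(E)$.
   Context: $\mathbb{R}_+$ denotes the nonnegative reals and $w(E)=\sum_{e\in E}w(e)$. The weighted cut function $d_w\colon 2^V\to\mathbb{R}$ assigns to $X\subseteq V$ the total weight of the edges with exactly one endpoint in $X$. A set function $\varphi\colon 2^V\to\mathbb{R}$ is increasing (decreasing) if $X\subseteq Y$ implies $\varphi(X)\le\varphi(Y)$ (respectively $\varphi(X)\ge\varphi(Y)$), and submodular if $\varphi(X)+\varphi(Y)\ge\varphi(X\cap Y)+\varphi(X\cup Y)$ for all $X,Y\subseteq V$. A monotonic sum-decomposition of $\varphi$ (with $\varphi(\emptyset)=0$) is $\varphi=\varphi_1+\varphi_2$ with $\varphi_1$ increasing submodular, $\varphi_2$ decreasing submodular, $\varphi_1(\emptyset)=\varphi_2(\emptyset)=0$. Define $\|\varphi\|_+=\min\{\varphi_1(V)\mid\varphi=\varphi_1+\varphi_2\text{ is a monotonic sum-decomposition}\}$. *)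

theory Defs
  imports "HOL-Analysis.Analysis"
begin

text \<open>
  A set function on the subsets of \<open>V\<close> is a total function of type \<open>'a set \<Rightarrow> real\<close> of which only the
  values on \<open>Pow V\<close> matter. Increasing and decreasing set functions are \<open>mono_on (Pow V)\<close> and
  \<open>antimono_on (Pow V)\<close>, where the order on sets is inclusion.
\<close>

definition submodular_on :: "'a set \<Rightarrow> ('a set \<Rightarrow> real) \<Rightarrow> bool" where
  "submodular_on V \<phi> \<longleftrightarrow>
     (\<forall>X\<in>Pow V. \<forall>Y\<in>Pow V. \<phi> X + \<phi> Y \<ge> \<phi> (X \<inter> Y) + \<phi> (X \<union> Y))"

definition monotonic_sum_decomposition ::
  "'a set \<Rightarrow> ('a set \<Rightarrow> real) \<Rightarrow> ('a set \<Rightarrow> real) \<Rightarrow> ('a set \<Rightarrow> real) \<Rightarrow> bool" where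
  "monotonic_sum_decomposition V \<phi> \<phi>1 \<phi>2 \<longleftrightarrow>
     (\<forall>X\<in>Pow V. \<phi> X = \<phi>1 X + \<phi>2 X) \<and>
     mono_on (Pow V) \<phi>1 \<and> submodular_on V \<phi>1 \<and> \<phi>1 {} = 0 \<and>
     antimono_on (Pow V) \<phi>2 \<and> submodular_on V \<phi>2 \<and> \<phi>2 {} = 0"

text \<open>
  The minimum of a set of reals that need not be finite, hence \<open>LEAST\<close> rather than \<open>Min\<close>.
  The lemma \<open>norm_plus_minimum\<close> shows that the minimum exists as soon as \<open>\<phi>\<close> has a monotonic
  sum-decomposition; otherwise the value is unspecified.
\<close>

definition norm_plus :: "'a set \<Rightarrow> ('a set \<Rightarrow> real) \<Rightarrow> real" where
  "norm_plus V \<phi> = (LEAST t. \<exists>\<phi>1 \<phi>2. monotonic_sum_decomposition V \<phi> \<phi>1 \<phi>2 \<and> t = \<phi>1 V)"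

lemma norm_plus_minimum:
  assumes "monotonic_sum_decomposition V \<phi> \<psi>1 \<psi>2"
  shows "\<exists>\<phi>1 \<phi>2. monotonic_sum_decomposition V \<phi> \<phi>1 \<phi>2 \<and> norm_plus V \<phi> = \<phi>1 V"
    and "norm_plus V \<phi> \<le> \<psi>1 V"
proof -
  define D where "D = (\<lambda>f. monotonic_sum_decomposition V \<phi> f (\<lambda>X. \<phi> X - f X))"
  note D_unfold = D_def monotonic_sum_decomposition_def submodular_on_def monotone_on_def Ball_def
  have D_I: "D f" if d: "monotonic_sum_decomposition V \<phi> f g" for f g
  proof -
    have "\<phi> X - f X = g X" if "X \<in> Pow V" for X
      using d that unfolding monotonic_sum_decomposition_def by simp
    moreover have "X \<inter> Y \<in> Pow V" "X \<union> Y \<in> Pow V" if "X \<in> Pow V" "Y \<in> Pow V" for X Y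
      using that by auto
    ultimately show ?thesis
      using d unfolding D_unfold by simp
  qed
  define c where "c = \<psi>1 V"
  define K where "K = Pi UNIV (\<lambda>_::'a set. {0..c}) \<inter> Collect D"
  have "compactin (product_topology (\<lambda>_::'a set. euclideanreal) UNIV) (PiE UNIV (\<lambda>_. {0..c}))"
    by (simp add: compactin_PiE)
  then have "compact (Pi UNIV (\<lambda>_::'a set. {0..c}))"
    by (simp add: euclidean_product_topology PiE_UNIV_domain)
  moreover have "closed (Collect D)"
    unfolding D_unfold
    by (intro closed_Collect_conj closed_Collect_all closed_Collect_imp open_Collect_const
        closed_Collect_le closed_Collect_eq continuous_intros continuous_on_product_coordinates)
  ultimately have "compact K"
    unfolding K_def by blast
  have restr: "(\<lambda>X. f (X \<inter> V)) \<in> K" if "D f" "f V \<le> c" for f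
  proof -
    have mono: "f X \<le> f Y" if "X \<subseteq> Y" "Y \<subseteq> V" for X Y
    proof -
      have "mono_on (Pow V) f"
        using \<open>D f\<close> unfolding D_def monotonic_sum_decomposition_def by simp
      then show ?thesis
        by (rule monotone_onD) (use that in auto)
    qed
    have "f {} = 0"
      using \<open>D f\<close> unfolding D_def monotonic_sum_decomposition_def by simp
    then have "0 \<le> f (X \<inter> V)" "f (X \<inter> V) \<le> c" for X
      using mono[of "{}" "X \<inter> V"] mono[of "X \<inter> V" V] \<open>f V \<le> c\<close> by auto
    moreover have "D (\<lambda>X. f (X \<inter> V))"
    proof -
      have "X \<inter> V = X" "(X \<inter> Y) \<inter> V = X \<inter> Y" "(X \<union> Y) \<inter> V = X \<union> Y"
        if "X \<in> Pow V" "Y \<in> Pow V" for X Y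
        using that by auto
      then show ?thesis
        using \<open>D f\<close> unfolding D_unfold by simp
    qed
    ultimately show ?thesis by (auto simp: K_def)
  qed
  have "(\<lambda>X. \<psi>1 (X \<inter> V)) \<in> K"
    using restr D_I[OF assms] by (simp add: c_def)
  then have "K \<noteq> {}" by auto
  moreover have "continuous_on K (\<lambda>f. f V)"
    by (rule continuous_on_subset[OF continuous_on_product_coordinates]) simp
  ultimately obtain f where f: "f \<in> K" "\<forall>g\<in>K. f V \<le> g V"
    using continuous_attains_inf[OF \<open>compact K\<close>] by metis
  have f_D: "D f" and f_le: "f V \<le> c"
    using f(1) by (auto simp: K_def Pi_iff)
  have min: "f V \<le> g V" if "monotonic_sum_decomposition V \<phi> g h" for g h
  proof (cases "g V \<le> c")
    case True
    then show ?thesis using bspec[OF f(2) restr[OF D_I[OF that]]] by simp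
  next
    case False
    then show ?thesis using f_le by simp
  qed
  have eq: "norm_plus V \<phi> = f V"
    unfolding norm_plus_def
  proof (rule Least_equality)
    show "\<exists>\<phi>1 \<phi>2. monotonic_sum_decomposition V \<phi> \<phi>1 \<phi>2 \<and> f V = \<phi>1 V"
      using f_D unfolding D_def by metis
  qed (use min in auto)
  show "\<exists>\<phi>1 \<phi>2. monotonic_sum_decomposition V \<phi> \<phi>1 \<phi>2 \<and> norm_plus V \<phi> = \<phi>1 V"
    using f_D eq unfolding D_def by metis
  show "norm_plus V \<phi> \<le> \<psi>1 V"
    using min[OF assms] eq by simp
qed

definition simple_graph :: "'a set \<Rightarrow> 'a set set \<Rightarrow> bool" where
  "simple_graph V E \<longleftrightarrow> (\<forall>e\<in>E. e \<subseteq> V \<and> card e = 2)"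

definition triangle_free :: "'a set set \<Rightarrow> bool" where
  "triangle_free E \<longleftrightarrow>
     \<not> (\<exists>x y z. x \<noteq> y \<and> y \<noteq> z \<and> x \<noteq> z \<and> {x, y} \<in> E \<and> {y, z} \<in> E \<and> {x, z} \<in> E)"

definition weighted_cut :: "'a set set \<Rightarrow> ('a set \<Rightarrow> real) \<Rightarrow> 'a set \<Rightarrow> real" where
  "weighted_cut E w X = (\<Sum>e | e \<in> E \<and> card (e \<inter> X) = 1. w e)"

end

theory Submission
  imports Defs
begin

text \<open>
  The upper bound is witnessed by the canonical decomposition that sends \<open>X\<close> to the weight of the
  edges meeting \<open>X\<close> and to minus the weight of the edges inside \<open>X\<close>
  (\<open>incident_minus_induced_decomposition\<close>).

  For the lower bound, let \<open>d = f + g\<close> be a monotonic sum-decomposition of the cut function. The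
  second difference of \<open>d\<close> in two nonadjacent vertices \<open>u\<close>, \<open>v\<close> vanishes, while those of \<open>f\<close> and
  \<open>g\<close> are both nonpositive by submodularity; so that of \<open>f\<close> vanishes too. A third difference of
  \<open>f\<close> is a difference of second differences in any two of its three directions, and among three
  vertices of a triangle-free graph some two are nonadjacent. Hence all third differences of \<open>f\<close>
  vanish: \<open>f\<close> is quadratic, \<open>f X = (\<Sum>v\<in>X. a v) - (\<Sum>{u, v}\<subseteq>X. b u v)\<close>.

  For a quadratic function the value on \<open>V\<close> is the sum over \<open>v\<close> of the average of the first marginal
  \<open>f {v}\<close> and the last marginal \<open>f V - f (V - {v})\<close> (\<open>quadratic_eq_sum_of_marginals\<close>). The last
  marginals are nonnegative because \<open>f\<close> is increasing, and \<open>f {v} \<ge> d {v}\<close> because \<open>g\<close> is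
  decreasing. So \<open>2 * f V\<close> is at least the sum of the weighted degrees, which is twice the total
  weight. In a triangle the argument breaks down, and so does the bound: with unit weights
  the total weight is \<open>3\<close>, but \<open>2\<close> is attained by \<open>f X = (if X = {} then 0 else 2)\<close>.
\<close>

section \<open>Set functions with vanishing differences\<close>

lemma modular_eq_sum:
  fixes g :: "'a set \<Rightarrow> real"
  assumes second_difference: "\<And>X u v. insert u (insert v X) \<subseteq> V \<Longrightarrow> u \<noteq> v \<Longrightarrow> u \<notin> X \<Longrightarrow> v \<notin> X \<Longrightarrow>
      g (insert u (insert v X)) + g X = g (insert u X) + g (insert v X)"
    and "finite X" and "X \<subseteq> V"
  shows "g X = g {} + (\<Sum>v\<in>X. g {v} - g {})"
proof -
  have marginal: "g (insert u Y) - g Y = g {u} - g {}"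
    if "finite Y" "insert u Y \<subseteq> V" "u \<notin> Y" for u Y
    using that
  proof (induction Y)
    case (insert v Y)
    then show ?case using second_difference[of u v Y] by auto
  qed simp
  show ?thesis
    using \<open>finite X\<close> \<open>X \<subseteq> V\<close>
  proof (induction X)
    case (insert u X)
    then show ?case using marginal[of X u] by simp
  qed simp
qed

text \<open>
  The marginal of a vertex in a quadratic set function is modular. Its linear coefficients are
  the second differences at the empty set, so they are symmetric in the two vertices; this is what
  makes the double counting below work.
\<close>

lemma quadratic_marginal:
  fixes f :: "'a set \<Rightarrow> real"
  assumes third_difference: "\<And>X u v x. insert u (insert v (insert x X)) \<subseteq> V \<Longrightarrow>
      u \<noteq> v \<Longrightarrow> u \<noteq> x \<Longrightarrow> v \<noteq> x \<Longrightarrow> u \<notin> X \<Longrightarrow> v \<notin> X \<Longrightarrow> x \<notin> X \<Longrightarrow>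
      f (insert u (insert v (insert x X))) + f (insert u X) + f (insert v X) + f (insert x X)
      = f (insert u (insert v X)) + f (insert u (insert x X)) + f (insert v (insert x X)) + f X"
    and "f {} = 0" and "finite X" and "insert u X \<subseteq> V" and "u \<notin> X"
  shows "f (insert u X) - f X = f {u} - (\<Sum>v\<in>X. f {u} + f {v} - f {u, v})"
proof -
  define g where "g = (\<lambda>Y. f (insert u Y) - f Y)"
  have "g X = g {} + (\<Sum>v\<in>X. g {v} - g {})"
  proof (rule modular_eq_sum[where V = "V - {u}"])
    fix Y v x
    assume "insert v (insert x Y) \<subseteq> V - {u}" and vx: "v \<noteq> x" "v \<notin> Y" "x \<notin> Y"
    then have "insert u (insert v (insert x Y)) \<subseteq> V" "u \<noteq> v" "u \<noteq> x" "u \<notin> Y"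
      using \<open>insert u X \<subseteq> V\<close> by auto
    then show "g (insert v (insert x Y)) + g Y = g (insert v Y) + g (insert x Y)"
      using third_difference[of u v x Y] vx by (simp add: g_def)
  qed (use assms in auto)
  moreover have "(\<Sum>v\<in>X. g {v} - g {}) = - (\<Sum>v\<in>X. f {u} + f {v} - f {u, v})"
    unfolding sum_negf[symmetric] by (rule sum.cong) (auto simp: g_def \<open>f {} = 0\<close>)
  ultimately show ?thesis
    by (simp add: g_def \<open>f {} = 0\<close>)
qed

text \<open>
  Summing the last marginals subtracts the quadratic coefficient of each pair once for either
  element, whereas the first marginals subtract none and \<open>f X\<close> subtracts it once: twice \<open>f X\<close> is the
  exact balance.
\<close>

lemma quadratic_eq_sum_of_marginals:
  fixes f :: "'a set \<Rightarrow> real"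
  assumes third_difference: "\<And>X u v x. insert u (insert v (insert x X)) \<subseteq> V \<Longrightarrow>
      u \<noteq> v \<Longrightarrow> u \<noteq> x \<Longrightarrow> v \<noteq> x \<Longrightarrow> u \<notin> X \<Longrightarrow> v \<notin> X \<Longrightarrow> x \<notin> X \<Longrightarrow>
      f (insert u (insert v (insert x X))) + f (insert u X) + f (insert v X) + f (insert x X)
      = f (insert u (insert v X)) + f (insert u (insert x X)) + f (insert v (insert x X)) + f X"
    and "f {} = 0" and "finite V"
  shows "2 * f V = (\<Sum>v\<in>V. f {v} + (f V - f (V - {v})))"
proof -
  define b where "b = (\<lambda>u v. f {u} + f {v} - f {u, v})"
  have b_sym: "b u v = b v u" for u v
    by (simp add: b_def insert_commute)
  have marginal: "f (insert u X) - f X = f {u} - (\<Sum>v\<in>X. b u v)"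
    if "finite X" "insert u X \<subseteq> V" "u \<notin> X" for u X
    unfolding b_def using quadratic_marginal[of V f X u, OF third_difference \<open>f {} = 0\<close> that] .
  have twice: "2 * f X = (\<Sum>v\<in>X. 2 * f {v} - (\<Sum>x\<in>X - {v}. b v x))"
    if "finite X" "X \<subseteq> V" for X
    using that
  proof (induction X)
    case (insert u X)
    have "(\<Sum>x\<in>insert u X - {v}. b v x) = b u v + (\<Sum>x\<in>X - {v}. b v x)" if "v \<in> X" for v
    proof -
      have "insert u X - {v} = insert u (X - {v})"
        using insert.hyps that by auto
      then show ?thesis
        using insert.hyps by (simp add: b_sym)
    qed
    then have "(\<Sum>v\<in>X. 2 * f {v} - (\<Sum>x\<in>insert u X - {v}. b v x))
        = (\<Sum>v\<in>X. (2 * f {v} - (\<Sum>x\<in>X - {v}. b v x)) - b u v)"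
      by (intro sum.cong) auto
    also have "\<dots> = 2 * f X - (\<Sum>v\<in>X. b u v)"
      using insert by (simp add: sum_subtractf)
    finally show ?case
      using insert marginal[of X u] by simp
  qed (simp add: \<open>f {} = 0\<close>)
  have "f V - f (V - {v}) = f {v} - (\<Sum>x\<in>V - {v}. b v x)" if "v \<in> V" for v
    using marginal[of "V - {v}" v] that \<open>finite V\<close> by (simp add: insert_absorb)
  then have "(\<Sum>v\<in>V. f {v} + (f V - f (V - {v}))) = (\<Sum>v\<in>V. 2 * f {v} - (\<Sum>x\<in>V - {v}. b v x))"
    by (intro sum.cong) auto
  then show ?thesis
    using twice[of V] \<open>finite V\<close> by simp
qed

section \<open>The weighted cut function\<close>

lemma finite_edges: "finite V \<Longrightarrow> simple_graph V E \<Longrightarrow> finite E"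
  by (rule finite_subset[of _ "Pow V"]) (auto simp: simple_graph_def)

lemma weighted_cut_eq_sum:
  "finite E \<Longrightarrow> weighted_cut E w X = (\<Sum>e\<in>E. if card (e \<inter> X) = 1 then w e else 0)"
  by (simp add: weighted_cut_def sum.If_cases Int_def)

text \<open>The handshake lemma, a weighted degree being the cut of a single vertex.\<close>

lemma sum_weighted_degrees:
  assumes "finite V" "simple_graph V E"
  shows "(\<Sum>v\<in>V. weighted_cut E w {v}) = 2 * (\<Sum>e\<in>E. w e)"
proof -
  have "(\<Sum>v\<in>V. weighted_cut E w {v}) = (\<Sum>v\<in>V. \<Sum>e\<in>E. if v \<in> e then w e else 0)"
    unfolding weighted_cut_eq_sum[OF finite_edges[OF assms]]
    by (intro sum.cong) auto
  also have "\<dots> = (\<Sum>e\<in>E. \<Sum>v\<in>V. if v \<in> e then w e else 0)"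
    by (rule sum.swap)
  also have "\<dots> = (\<Sum>e\<in>E. 2 * w e)"
  proof (rule sum.cong)
    fix e assume "e \<in> E"
    then have "V \<inter> e = e" "card e = 2"
      using assms(2) by (auto simp: simple_graph_def)
    then show "(\<Sum>v\<in>V. if v \<in> e then w e else 0) = 2 * w e"
      using \<open>finite V\<close> by (simp add: sum.inter_restrict[symmetric])
  qed simp
  finally show ?thesis
    by (simp add: sum_distrib_left)
qed

text \<open>
  Each edge misses one of two nonadjacent vertices, and adding that vertex does not change whether
  the edge is cut.
\<close>

lemma weighted_cut_nonadjacent:
  assumes "finite V" "simple_graph V E" "u \<noteq> v" "{u, v} \<notin> E"
  shows "weighted_cut E w (insert u (insert v X)) + weighted_cut E w X
    = weighted_cut E w (insert u X) + weighted_cut E w (insert v X)"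
proof -
  have misses: "u \<notin> e \<or> v \<notin> e" if "e \<in> E" for e
  proof (rule ccontr)
    assume "\<not> (u \<notin> e \<or> v \<notin> e)"
    then have "e = {u, v}"
      using that assms(2,3) by (auto simp: simple_graph_def card_2_iff)
    then show False using that assms(4) by simp
  qed
  show ?thesis
    unfolding weighted_cut_eq_sum[OF finite_edges[OF assms(1,2)]] sum.distrib[symmetric]
  proof (rule sum.cong)
    fix e assume "e \<in> E"
    then consider "u \<notin> e" | "v \<notin> e"
      using misses by blast
    then show "(if card (e \<inter> insert u (insert v X)) = 1 then w e else 0)
        + (if card (e \<inter> X) = 1 then w e else 0)
      = (if card (e \<inter> insert u X) = 1 then w e else 0)
        + (if card (e \<inter> insert v X) = 1 then w e else 0)"
    proof cases
      case 1
      then have "e \<inter> insert u Y = e \<inter> Y" for Y by simp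
      then show ?thesis by (simp only: add.commute)
    next
      case 2
      then have "e \<inter> insert v Y = e \<inter> Y" for Y by simp
      then show ?thesis by (simp only: insert_commute[of u v X])
    qed
  qed simp
qed

lemma incident_minus_induced_decomposition:
  fixes V :: "'a set" and w :: "'a set \<Rightarrow> real"
  assumes "finite V" "simple_graph V E" and nonneg: "\<And>e. e \<in> E \<Longrightarrow> 0 \<le> w e"
  shows "monotonic_sum_decomposition V (weighted_cut E w)
    (\<lambda>X. \<Sum>e\<in>E. if e \<inter> X \<noteq> {} then w e else 0) (\<lambda>X. \<Sum>e\<in>E. if e \<subseteq> X then - w e else 0)"
  unfolding monotonic_sum_decomposition_def submodular_on_def
proof (intro conjI ballI)
  have card: "card e = 2" if "e \<in> E" for e
    using that assms(2) by (simp add: simple_graph_def)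
  show "weighted_cut E w X = (\<Sum>e\<in>E. if e \<inter> X \<noteq> {} then w e else 0)
      + (\<Sum>e\<in>E. if e \<subseteq> X then - w e else 0)" for X
    unfolding weighted_cut_eq_sum[OF finite_edges[OF assms(1,2)]] sum.distrib[symmetric]
  proof (rule sum.cong)
    fix e assume "e \<in> E"
    then obtain p q where "e = {p, q}" "p \<noteq> q"
      using card[of e] unfolding card_2_iff by blast
    then show "(if card (e \<inter> X) = 1 then w e else 0)
        = (if e \<inter> X \<noteq> {} then w e else 0) + (if e \<subseteq> X then - w e else 0)"
      by (cases "p \<in> X"; cases "q \<in> X") auto
  qed simp
  show "mono_on (Pow V) (\<lambda>X. \<Sum>e\<in>E. if e \<inter> X \<noteq> {} then w e else 0)"
  proof (intro monotone_onI sum_mono)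
    fix X Y e :: "'a set" assume "X \<subseteq> Y" "e \<in> E"
    then have "e \<inter> X \<noteq> {} \<Longrightarrow> e \<inter> Y \<noteq> {}" "0 \<le> w e"
      using nonneg by auto
    then show "(if e \<inter> X \<noteq> {} then w e else 0) \<le> (if e \<inter> Y \<noteq> {} then w e else 0)"
      by simp
  qed
  show "antimono_on (Pow V) (\<lambda>X. \<Sum>e\<in>E. if e \<subseteq> X then - w e else 0)"
  proof (intro monotone_onI sum_mono)
    fix X Y e :: "'a set" assume "X \<subseteq> Y" "e \<in> E"
    then have "e \<subseteq> X \<Longrightarrow> e \<subseteq> Y" "0 \<le> w e"
      using nonneg by auto
    then show "(if e \<subseteq> Y then - w e else 0) \<le> (if e \<subseteq> X then - w e else 0)"
      by simp
  qed
  show "(\<Sum>e\<in>E. if e \<inter> (X \<inter> Y) \<noteq> {} then w e else 0) + (\<Sum>e\<in>E. if e \<inter> (X \<union> Y) \<noteq> {} then w e else 0)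
    \<le> (\<Sum>e\<in>E. if e \<inter> X \<noteq> {} then w e else 0) + (\<Sum>e\<in>E. if e \<inter> Y \<noteq> {} then w e else 0)" for X Y
    unfolding sum.distrib[symmetric]
  proof (rule sum_mono)
    fix e assume "e \<in> E"
    then have "0 \<le> w e" by (rule nonneg)
    moreover have "e \<inter> (X \<union> Y) = {} \<longleftrightarrow> e \<inter> X = {} \<and> e \<inter> Y = {}"
      "e \<inter> X = {} \<or> e \<inter> Y = {} \<Longrightarrow> e \<inter> (X \<inter> Y) = {}"
      by auto
    ultimately show "(if e \<inter> (X \<inter> Y) \<noteq> {} then w e else 0) + (if e \<inter> (X \<union> Y) \<noteq> {} then w e else 0)
      \<le> (if e \<inter> X \<noteq> {} then w e else 0) + (if e \<inter> Y \<noteq> {} then w e else 0)"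
      by (cases "e \<inter> X = {}"; cases "e \<inter> Y = {}") simp_all
  qed
  show "(\<Sum>e\<in>E. if e \<subseteq> X \<inter> Y then - w e else 0) + (\<Sum>e\<in>E. if e \<subseteq> X \<union> Y then - w e else 0)
    \<le> (\<Sum>e\<in>E. if e \<subseteq> X then - w e else 0) + (\<Sum>e\<in>E. if e \<subseteq> Y then - w e else 0)" for X Y
    unfolding sum.distrib[symmetric]
  proof (rule sum_mono)
    fix e assume "e \<in> E"
    then have "0 \<le> w e" by (rule nonneg)
    moreover have "e \<subseteq> X \<inter> Y \<longleftrightarrow> e \<subseteq> X \<and> e \<subseteq> Y" "e \<subseteq> X \<or> e \<subseteq> Y \<Longrightarrow> e \<subseteq> X \<union> Y"
      by auto
    ultimately show "(if e \<subseteq> X \<inter> Y then - w e else 0) + (if e \<subseteq> X \<union> Y then - w e else 0)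
      \<le> (if e \<subseteq> X then - w e else 0) + (if e \<subseteq> Y then - w e else 0)"
      by (cases "e \<subseteq> X"; cases "e \<subseteq> Y") simp_all
  qed
  show "(\<Sum>e\<in>E. if e \<subseteq> {} then - w e else 0) = 0"
    using card[of "{}"] by (intro sum.neutral) auto
qed simp

section \<open>The lower bound in triangle-free graphs\<close>

text \<open>
  Submodularity of both summands bounds their second differences from the same side; as these add
  up to zero on a nonadjacent pair, each of them is zero.
\<close>

lemma decomposition_nonadjacent:
  assumes "finite V" "simple_graph V E"
    and dec: "monotonic_sum_decomposition V (weighted_cut E w) f g"
    and "u \<noteq> v" "{u, v} \<notin> E" "insert u (insert v X) \<subseteq> V" "u \<notin> X" "v \<notin> X"
  shows "f (insert u (insert v X)) + f X = f (insert u X) + f (insert v X)"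
proof -
  have lattice: "insert u X \<inter> insert v X = X" "insert u X \<union> insert v X = insert u (insert v X)"
    using assms by auto
  have "h (insert u (insert v X)) + h X \<le> h (insert u X) + h (insert v X)"
    if "submodular_on V h" for h
  proof -
    have "insert u X \<in> Pow V" "insert v X \<in> Pow V"
      using assms by auto
    then have "h (insert u X \<inter> insert v X) + h (insert u X \<union> insert v X)
        \<le> h (insert u X) + h (insert v X)"
      using that unfolding submodular_on_def by blast
    then show ?thesis
      unfolding lattice by simp
  qed
  from this[of f] this[of g] show ?thesis
    using dec weighted_cut_nonadjacent[OF assms(1,2,4,5), of w X] assms(6)
    unfolding monotonic_sum_decomposition_def by auto
qed

lemma decomposition_third_difference:
  assumes "finite V" "simple_graph V E" "triangle_free E"
    and dec: "monotonic_sum_decomposition V (weighted_cut E w) f g"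
    and sub: "insert u (insert v (insert x X)) \<subseteq> V"
    and distinct: "u \<noteq> v" "u \<noteq> x" "v \<noteq> x" "u \<notin> X" "v \<notin> X" "x \<notin> X"
  shows "f (insert u (insert v (insert x X))) + f (insert u X) + f (insert v X) + f (insert x X)
      = f (insert u (insert v X)) + f (insert u (insert x X)) + f (insert v (insert x X)) + f X"
proof -
  note second = decomposition_nonadjacent[OF assms(1,2) dec]
  consider "{u, v} \<notin> E" | "{v, x} \<notin> E" | "{u, x} \<notin> E"
    using assms(3) distinct unfolding triangle_free_def by blast
  then show ?thesis
  proof cases
    case 1
    then show ?thesis
      using second[of u v X] second[of u v "insert x X"] sub distinct
      by (simp add: insert_commute)
  next
    case 2
    then show ?thesis
      using second[of v x X] second[of v x "insert u X"] sub distinct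
      by (simp add: insert_commute)
  next
    case 3
    then show ?thesis
      using second[of u x X] second[of u x "insert v X"] sub distinct
      by (simp add: insert_commute)
  qed
qed

lemma decomposition_lower_bound:
  assumes "finite V" "simple_graph V E" "triangle_free E"
    and dec: "monotonic_sum_decomposition V (weighted_cut E w) f g"
  shows "(\<Sum>e\<in>E. w e) \<le> f V"
proof -
  have f_mono: "mono_on (Pow V) f" and g_antimono: "antimono_on (Pow V) g"
    and f0: "f {} = 0" and g0: "g {} = 0"
    and split: "\<And>X. X \<subseteq> V \<Longrightarrow> weighted_cut E w X = f X + g X"
    using dec unfolding monotonic_sum_decomposition_def by auto
  have "2 * (\<Sum>e\<in>E. w e) = (\<Sum>v\<in>V. weighted_cut E w {v})"
    using sum_weighted_degrees[OF assms(1,2)] by simp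
  also have "\<dots> \<le> (\<Sum>v\<in>V. f {v} + (f V - f (V - {v})))"
  proof (rule sum_mono)
    fix v assume "v \<in> V"
    then have "g {v} \<le> g {}" "f (V - {v}) \<le> f V"
      using monotone_onD[OF g_antimono, of "{}" "{v}"] monotone_onD[OF f_mono, of "V - {v}" V]
      by auto
    then show "weighted_cut E w {v} \<le> f {v} + (f V - f (V - {v}))"
      using split[of "{v}"] \<open>v \<in> V\<close> g0 by simp
  qed
  also have "\<dots> = 2 * f V"
  proof (rule quadratic_eq_sum_of_marginals[symmetric])
    show "f (insert u (insert v (insert x X))) + f (insert u X) + f (insert v X) + f (insert x X)
      = f (insert u (insert v X)) + f (insert u (insert x X)) + f (insert v (insert x X)) + f X"
      if "insert u (insert v (insert x X)) \<subseteq> V" "u \<noteq> v" "u \<noteq> x" "v \<noteq> x" "u \<notin> X" "v \<notin> X" "x \<notin> X"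
      for X u v x
      by (rule decomposition_third_difference[OF assms that])
  qed (fact f0 assms(1))+
  finally show ?thesis by simp
qed

theorem theorem7p4:
  fixes V :: "'a set" and E :: "'a set set" and w :: "'a set \<Rightarrow> real"
  assumes "finite V"
    and "simple_graph V E"
    and "triangle_free E"
    and "\<And>e. e \<in> E \<Longrightarrow> 0 \<le> w e"
  shows "norm_plus V (weighted_cut E w) = (\<Sum>e\<in>E. w e)"
proof (rule antisym)
  have dec: "monotonic_sum_decomposition V (weighted_cut E w)
      (\<lambda>X. \<Sum>e\<in>E. if e \<inter> X \<noteq> {} then w e else 0) (\<lambda>X. \<Sum>e\<in>E. if e \<subseteq> X then - w e else 0)"
    by (rule incident_minus_induced_decomposition) (fact assms)+
  have "e \<inter> V \<noteq> {}" if "e \<in> E" for e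
  proof -
    have "e \<subseteq> V" "card e = 2"
      using that assms(2) unfolding simple_graph_def by blast+
    then have "e \<inter> V = e" "e \<noteq> {}" by auto
    then show ?thesis by simp
  qed
  then have "(\<Sum>e\<in>E. if e \<inter> V \<noteq> {} then w e else 0) = (\<Sum>e\<in>E. w e)"
    by (intro sum.cong) simp_all
  then show "norm_plus V (weighted_cut E w) \<le> (\<Sum>e\<in>E. w e)"
    using norm_plus_minimum(2)[OF dec] by (rule subst)
  obtain f g where "monotonic_sum_decomposition V (weighted_cut E w) f g"
    and norm_eq: "norm_plus V (weighted_cut E w) = f V"
    using norm_plus_minimum(1)[OF dec] by (elim exE conjE)
  then have "(\<Sum>e\<in>E. w e) \<le> f V"
    using decomposition_lower_bound[OF assms(1-3)] by blast
  then show "(\<Sum>e\<in>E. w e) \<le> norm_plus V (weighted_cut E w)"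
    unfolding norm_eq .
qed

end
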